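(* For all $\varphi,\psi\in\mathsf{Form}$: $$\{\varphi\}\vdash_{\mathsf F}\psi \iff \varphi^{\mathrm O}\vdash_{\mathsf{ITB}}\psi^{\mathrm O}.$$
   Context: **Source language.** $\mathsf{Prop}$ is a countable set of propositional variables; $\mathsf{Form}$ is generated by $\varphi::=p\mid\bot\mid\top\mid(\varphi\wedge\varphi)\mid(\varphi\vee\varphi)\mid(\varphi\to\varphi)$, $p\in\mathsf{Prop}$, and $\neg\alpha:=\alpha\to\bot$. **System $\mathsf F$.** $\vdash_{\mathsf F}$ is the smallest relation ${\vdash}\subseteq\wp(\mathsf{Form})\times\mathsf{Form}$ satisfying the following for all $\Gamma,\Delta\subseteq\mathsf{Form}$ and $\alpha,\alpha',\beta,\varphi,\psi\in\mathsf{Form}$ (where $\Gamma,\varphi\vdash\psi$ means $\Gamma\cup\{\varphi\}\vdash\psi$, $\varphi\vdash\psi$ means $\{\varphi\}\vdash\psi$, $\vdash\varphi$ means $\varnothing\vdash\varphi$, and $\alpha\dashv\vdash\beta$ means $\alpha\vdash\beta$ and $\beta\vdash\alpha$): (A) $\Gamma,\varphi\vdash\varphi$; (Cut) if $\Gamma,\psi\vdash\varphi$ and $\Delta\vdash\psi$ then $\Gamma\cup\Delta\vdash\varphi$; ($\wedge$I) $\{\varphi,\psi\}\vdash\varphi\wedge\psi$; ($\wedge$E) $\varphi\wedge\psi\vdash\varphi$ and $\varphi\wedge\psi\vdash\psi$; ($\vee$I) $\varphi\vdash\varphi\vee\psi$ and $\psi\vdash\varphi\vee\psi$; ($\vee$E)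 if $\varphi\vdash\alpha$ and $\psi\vdash\alpha$ then $\varphi\vee\psi\vdash\alpha$; ($\bot$E) $\bot\vdash\varphi$; ($\top$) $\vdash\top$; ($\top\to$E) $\top\to\varphi\vdash\varphi$; (Con) if $\alpha\wedge\beta\vdash\psi$ then $\alpha\to\beta\vdash\alpha\to\psi$; ($\wedge{\vdash}\to$) $\alpha\wedge\beta\vdash\alpha\to\beta$; (Imp) if $\alpha\wedge\beta\vdash\varphi$ then $\varphi\to(\alpha\to\beta)\vdash(\varphi\wedge\alpha)\to\beta$; (Rep) if $\alpha\dashv\vdash\alpha'$ then $\alpha\to\beta\dashv\vdash\alpha'\to\beta$; ($\to$Id) $\vdash\alpha\to\alpha$; (Exp) $\{\alpha,\neg\alpha\}\vdash\bot$; ($\neg\neg$I) $\alpha\vdash\neg\neg\alpha$. **Target logic intuitionistic KTB.** $\mathcal L_{\Box\Diamond}$ is generated by $\varphi::=p\mid\bot\mid(\varphi\wedge\varphi)\mid(\varphi\vee\varphi)\mid(\varphi\to\varphi)\mid\Box\varphi\mid\Diamond\varphi$, with $\neg\varphi:=\varphi\to\bot$ and $\top:=\bot\to\bot$. $\vdash_{\mathsf{ITB}}$ is the smallest binary relation on $\mathcal L_{\Box\Diamond}$ such that for all $\varphi,\psi,\chi,\alpha,\beta$: (i1) $\varphi\vdash\varphi$; if $\varphi\vdash\psi$ and $\psi\vdash\chi$ then $\varphi\vdash\chi$; $\bot\vdash\varphi$; (i2) $\varphi\wedge\psi\vdash\varphi$; $\varphi\wedge\psi\vdash\psi$; if $\varphi\vdash\psi$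 and $\varphi\vdash\chi$ then $\varphi\vdash\psi\wedge\chi$; (i3) $\varphi\vdash\varphi\vee\psi$; $\psi\vdash\varphi\vee\psi$; if $\varphi\wedge\alpha\vdash\chi$ and $\varphi\wedge\beta\vdash\chi$ then $\varphi\wedge(\alpha\vee\beta)\vdash\chi$; (i4) $\varphi\wedge\psi\vdash\chi$ if and only if $\varphi\vdash\psi\to\chi$; (i5) if $\varphi\vdash\psi$ then $\Box\varphi\vdash\Box\psi$ and $\Diamond\varphi\vdash\Diamond\psi$; $\Box\varphi\wedge\Box\psi\vdash\Box(\varphi\wedge\psi)$; $\top\vdash\Box\top$; $\Diamond(\varphi\vee\psi)\vdash\Diamond\varphi\vee\Diamond\psi$; $\Diamond\bot\vdash\bot$; (i6) $\Diamond(\varphi\to\psi)\vdash\Box\varphi\to\Diamond\psi$; $(\Diamond\varphi\to\Box\psi)\vdash\Box(\varphi\to\psi)$; (i7) $\Box\varphi\vdash\varphi$; $\varphi\vdash\Diamond\varphi$; (i8) $\varphi\vdash\Box\Diamond\varphi$; $\Diamond\Box\varphi\vdash\varphi$. **Translation.** $(\cdot)^{\mathrm O}:\mathsf{Form}\to\mathcal L_{\Box\Diamond}$ is defined by $\bot^{\mathrm O}=\bot$, $\top^{\mathrm O}=\top$, $p^{\mathrm O}=\Box\Diamond p$, $(\alpha\wedge\beta)^{\mathrm O}=\alpha^{\mathrm O}\wedge\beta^{\mathrm O}$, $(\alpha\vee\beta)^{\mathrm O}=\Box\Diamond(\alpha^{\mathrm O}\vee\beta^{\mathrm O})$, and $(\alpha\to\beta)^{\mathrm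 O}=\Box\bigl(\alpha^{\mathrm O}\to\Diamond(\alpha^{\mathrm O}\wedge\beta^{\mathrm O})\bigr)$, where the arrow on the right is the intuitionistic implication of $\mathcal L_{\Box\Diamond}$. *)

theory Defs
  imports "HOL-Library.Countable"
begin

datatype 'p form =
    Var 'p
  | Bot ("\<^bold>\<bottom>")
  | Top ("\<^bold>\<top>")
  | And "'p form" "'p form" (infixr "\<^bold>\<and>" 75)
  | Or "'p form" "'p form" (infixr "\<^bold>\<or>" 70)
  | Imp "'p form" "'p form" (infixr "\<^bold>\<rightarrow>" 65)

abbreviation Neg :: "'p form \<Rightarrow> 'p form" ("\<^bold>\<not> _" [80] 80) where
  "\<^bold>\<not> \<alpha> \<equiv> \<alpha> \<^bold>\<rightarrow> \<^bold>\<bottom>"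

text \<open>
  The two conclusions of the replacement rule (from interderivability of \<open>\<alpha>\<close> and \<open>\<alpha>'\<close>
  infer interderivability of the two implications) are separate clauses \<open>F_Rep1\<close> and \<open>F_Rep2\<close>.
\<close>

inductive F_entails :: "'p form set \<Rightarrow> 'p form \<Rightarrow> bool" (infix "\<turnstile>\<^sub>F" 50) where
  F_A: "insert \<phi> \<Gamma> \<turnstile>\<^sub>F \<phi>"
| F_Cut: "insert \<psi> \<Gamma> \<turnstile>\<^sub>F \<phi> \<Longrightarrow> \<Delta> \<turnstile>\<^sub>F \<psi> \<Longrightarrow> \<Gamma> \<union> \<Delta> \<turnstile>\<^sub>F \<phi>"
| F_andI: "{\<phi>, \<psi>} \<turnstile>\<^sub>F \<phi> \<^bold>\<and> \<psi>"
| F_andE1: "{\<phi> \<^bold>\<and> \<psi>} \<turnstile>\<^sub>F \<phi>"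
| F_andE2: "{\<phi> \<^bold>\<and> \<psi>} \<turnstile>\<^sub>F \<psi>"
| F_orI1: "{\<phi>} \<turnstile>\<^sub>F \<phi> \<^bold>\<or> \<psi>"
| F_orI2: "{\<psi>} \<turnstile>\<^sub>F \<phi> \<^bold>\<or> \<psi>"
| F_orE: "{\<phi>} \<turnstile>\<^sub>F \<alpha> \<Longrightarrow> {\<psi>} \<turnstile>\<^sub>F \<alpha> \<Longrightarrow> {\<phi> \<^bold>\<or> \<psi>} \<turnstile>\<^sub>F \<alpha>"
| F_botE: "{\<^bold>\<bottom>} \<turnstile>\<^sub>F \<phi>"
| F_top: "{} \<turnstile>\<^sub>F \<^bold>\<top>"
| F_top_impE: "{\<^bold>\<top> \<^bold>\<rightarrow> \<phi>} \<turnstile>\<^sub>F \<phi>"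
| F_Con: "{\<alpha> \<^bold>\<and> \<beta>} \<turnstile>\<^sub>F \<psi> \<Longrightarrow> {\<alpha> \<^bold>\<rightarrow> \<beta>} \<turnstile>\<^sub>F \<alpha> \<^bold>\<rightarrow> \<psi>"
| F_and_imp: "{\<alpha> \<^bold>\<and> \<beta>} \<turnstile>\<^sub>F \<alpha> \<^bold>\<rightarrow> \<beta>"
| F_Imp: "{\<alpha> \<^bold>\<and> \<beta>} \<turnstile>\<^sub>F \<phi> \<Longrightarrow> {\<phi> \<^bold>\<rightarrow> (\<alpha> \<^bold>\<rightarrow> \<beta>)} \<turnstile>\<^sub>F (\<phi> \<^bold>\<and> \<alpha>) \<^bold>\<rightarrow> \<beta>"
| F_Rep1: "{\<alpha>} \<turnstile>\<^sub>F \<alpha>' \<Longrightarrow> {\<alpha>'} \<turnstile>\<^sub>F \<alpha> \<Longrightarrow> {\<alpha> \<^bold>\<rightarrow> \<beta>} \<turnstile>\<^sub>F \<alpha>' \<^bold>\<rightarrow> \<beta>"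
| F_Rep2: "{\<alpha>} \<turnstile>\<^sub>F \<alpha>' \<Longrightarrow> {\<alpha>'} \<turnstile>\<^sub>F \<alpha> \<Longrightarrow> {\<alpha>' \<^bold>\<rightarrow> \<beta>} \<turnstile>\<^sub>F \<alpha> \<^bold>\<rightarrow> \<beta>"
| F_imp_Id: "{} \<turnstile>\<^sub>F \<alpha> \<^bold>\<rightarrow> \<alpha>"
| F_Exp: "{\<alpha>, \<^bold>\<not> \<alpha>} \<turnstile>\<^sub>F \<^bold>\<bottom>"
| F_notnotI: "{\<alpha>} \<turnstile>\<^sub>F \<^bold>\<not> (\<^bold>\<not> \<alpha>)"

datatype 'p mform =
    MVar 'p
  | MBot ("\<^bold>\<bottom>\<^sub>m")
  | MAnd "'p mform" "'p mform" (infixr "\<^bold>\<and>\<^sub>m" 75)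
  | MOr "'p mform" "'p mform" (infixr "\<^bold>\<or>\<^sub>m" 70)
  | MImp "'p mform" "'p mform" (infixr "\<^bold>\<rightarrow>\<^sub>m" 65)
  | Box "'p mform" ("\<box> _" [80] 80)
  | Dia "'p mform" ("\<diamond> _" [80] 80)

abbreviation MTop :: "'p mform" ("\<^bold>\<top>\<^sub>m") where
  "\<^bold>\<top>\<^sub>m \<equiv> \<^bold>\<bottom>\<^sub>m \<^bold>\<rightarrow>\<^sub>m \<^bold>\<bottom>\<^sub>m"

text \<open>
  Intuitionistic KTB: intuitionistic propositional logic with normal \<open>\<box>\<close> and \<open>\<diamond>\<close>,
  linked by the two Fischer Servi axioms, plus the \<open>T\<close> and \<open>B\<close> axioms for both modalities.
\<close>

inductive ITB_entails :: "'p mform \<Rightarrow> 'p mform \<Rightarrow> bool" (infix "\<turnstile>\<^sub>I\<^sub>T\<^sub>B" 50) where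
  I_refl: "\<phi> \<turnstile>\<^sub>I\<^sub>T\<^sub>B \<phi>"
| I_trans: "\<phi> \<turnstile>\<^sub>I\<^sub>T\<^sub>B \<psi> \<Longrightarrow> \<psi> \<turnstile>\<^sub>I\<^sub>T\<^sub>B \<chi> \<Longrightarrow> \<phi> \<turnstile>\<^sub>I\<^sub>T\<^sub>B \<chi>"
| I_botE: "\<^bold>\<bottom>\<^sub>m \<turnstile>\<^sub>I\<^sub>T\<^sub>B \<phi>"
| I_andE1: "\<phi> \<^bold>\<and>\<^sub>m \<psi> \<turnstile>\<^sub>I\<^sub>T\<^sub>B \<phi>"
| I_andE2: "\<phi> \<^bold>\<and>\<^sub>m \<psi> \<turnstile>\<^sub>I\<^sub>T\<^sub>B \<psi>"
| I_andI: "\<phi> \<turnstile>\<^sub>I\<^sub>T\<^sub>B \<psi> \<Longrightarrow> \<phi> \<turnstile>\<^sub>I\<^sub>T\<^sub>B \<chi> \<Longrightarrow> \<phi> \<turnstile>\<^sub>I\<^sub>T\<^sub>B \<psi> \<^bold>\<and>\<^sub>m \<chi>"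
| I_orI1: "\<phi> \<turnstile>\<^sub>I\<^sub>T\<^sub>B \<phi> \<^bold>\<or>\<^sub>m \<psi>"
| I_orI2: "\<psi> \<turnstile>\<^sub>I\<^sub>T\<^sub>B \<phi> \<^bold>\<or>\<^sub>m \<psi>"
| I_orE: "\<phi> \<^bold>\<and>\<^sub>m \<alpha> \<turnstile>\<^sub>I\<^sub>T\<^sub>B \<chi> \<Longrightarrow> \<phi> \<^bold>\<and>\<^sub>m \<beta> \<turnstile>\<^sub>I\<^sub>T\<^sub>B \<chi> \<Longrightarrow> \<phi> \<^bold>\<and>\<^sub>m (\<alpha> \<^bold>\<or>\<^sub>m \<beta>) \<turnstile>\<^sub>I\<^sub>T\<^sub>B \<chi>"
| I_impI: "\<phi> \<^bold>\<and>\<^sub>m \<psi> \<turnstile>\<^sub>I\<^sub>T\<^sub>B \<chi> \<Longrightarrow> \<phi> \<turnstile>\<^sub>I\<^sub>T\<^sub>B \<psi> \<^bold>\<rightarrow>\<^sub>m \<chi>"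
| I_impE: "\<phi> \<turnstile>\<^sub>I\<^sub>T\<^sub>B \<psi> \<^bold>\<rightarrow>\<^sub>m \<chi> \<Longrightarrow> \<phi> \<^bold>\<and>\<^sub>m \<psi> \<turnstile>\<^sub>I\<^sub>T\<^sub>B \<chi>"
| I_box_mono: "\<phi> \<turnstile>\<^sub>I\<^sub>T\<^sub>B \<psi> \<Longrightarrow> \<box> \<phi> \<turnstile>\<^sub>I\<^sub>T\<^sub>B \<box> \<psi>"
| I_dia_mono: "\<phi> \<turnstile>\<^sub>I\<^sub>T\<^sub>B \<psi> \<Longrightarrow> \<diamond> \<phi> \<turnstile>\<^sub>I\<^sub>T\<^sub>B \<diamond> \<psi>"
| I_box_and: "\<box> \<phi> \<^bold>\<and>\<^sub>m \<box> \<psi> \<turnstile>\<^sub>I\<^sub>T\<^sub>B \<box> (\<phi> \<^bold>\<and>\<^sub>m \<psi>)"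
| I_box_top: "\<^bold>\<top>\<^sub>m \<turnstile>\<^sub>I\<^sub>T\<^sub>B \<box> \<^bold>\<top>\<^sub>m"
| I_dia_or: "\<diamond> (\<phi> \<^bold>\<or>\<^sub>m \<psi>) \<turnstile>\<^sub>I\<^sub>T\<^sub>B \<diamond> \<phi> \<^bold>\<or>\<^sub>m \<diamond> \<psi>"
| I_dia_bot: "\<diamond> \<^bold>\<bottom>\<^sub>m \<turnstile>\<^sub>I\<^sub>T\<^sub>B \<^bold>\<bottom>\<^sub>m"
| I_dia_imp: "\<diamond> (\<phi> \<^bold>\<rightarrow>\<^sub>m \<psi>) \<turnstile>\<^sub>I\<^sub>T\<^sub>B \<box> \<phi> \<^bold>\<rightarrow>\<^sub>m \<diamond> \<psi>"
| I_imp_box: "\<diamond> \<phi> \<^bold>\<rightarrow>\<^sub>m \<box> \<psi> \<turnstile>\<^sub>I\<^sub>T\<^sub>B \<box> (\<phi> \<^bold>\<rightarrow>\<^sub>m \<psi>)"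
| I_T_box: "\<box> \<phi> \<turnstile>\<^sub>I\<^sub>T\<^sub>B \<phi>"
| I_T_dia: "\<phi> \<turnstile>\<^sub>I\<^sub>T\<^sub>B \<diamond> \<phi>"
| I_B_box: "\<phi> \<turnstile>\<^sub>I\<^sub>T\<^sub>B \<box> (\<diamond> \<phi>)"
| I_B_dia: "\<diamond> (\<box> \<phi>) \<turnstile>\<^sub>I\<^sub>T\<^sub>B \<phi>"

primrec transO :: "'p form \<Rightarrow> 'p mform" ("_\<^sup>O" [1000] 1000) where
  "(Var p)\<^sup>O = \<box> (\<diamond> (MVar p))"
| "\<^bold>\<bottom>\<^sup>O = \<^bold>\<bottom>\<^sub>m"
| "\<^bold>\<top>\<^sup>O = \<^bold>\<top>\<^sub>m"
| "(\<alpha> \<^bold>\<and> \<beta>)\<^sup>O = \<alpha>\<^sup>O \<^bold>\<and>\<^sub>m \<beta>\<^sup>O"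
| "(\<alpha> \<^bold>\<or> \<beta>)\<^sup>O = \<box> (\<diamond> (\<alpha>\<^sup>O \<^bold>\<or>\<^sub>m \<beta>\<^sup>O))"
| "(\<alpha> \<^bold>\<rightarrow> \<beta>)\<^sup>O = \<box> (\<alpha>\<^sup>O \<^bold>\<rightarrow>\<^sub>m \<diamond> (\<alpha>\<^sup>O \<^bold>\<and>\<^sub>m \<beta>\<^sup>O))"

end

theory Submission
  imports Defs
begin

text \<open>
  The translation reads a formula of \<open>F\<close> as a proposition of a relational frame whose accessibility
  relation \<open>S\<close> serves both \<open>\<box>\<close> and \<open>\<diamond>\<close>: \<open>\<box>\<close> looks forward along \<open>S\<close> and \<open>\<diamond>\<close> looks backward. The
  \<open>B\<close> axioms say exactly that \<open>\<diamond>\<close> is left adjoint to \<open>\<box>\<close>, so \<open>\<box>\<diamond>\<close> is a closure operator, and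
  all formulas \<open>\<alpha>\<^sup>O\<close> are closed under it (\<open>box_dia_transO\<close>). This is why disjunction, which
  the translation closes explicitly, satisfies its elimination rule without side formulas; the
  remaining rules of \<open>F\<close> are short calculations (\<open>F_entails_transO\<close>).

  For the converse, every underivable \<open>\<phi> \<turnstile> \<psi>\<close> is refuted in one canonical model of \<open>ITB\<close>. Its
  worlds are disjoint pairs of a filter \<open>T\<close> of accepted and an ideal \<open>R\<close> of rejected formulas such
  that accepting \<open>\<alpha>\<close> and rejecting \<open>\<alpha> \<and> \<beta>\<close> entails rejecting \<open>\<alpha> \<rightarrow> \<beta>\<close>; and \<open>x S y\<close> holds when \<open>y\<close>
  rejects nothing that \<open>x\<close> accepts. Filters and ideals need not be prime: disjunctions are
  interpreted as closures of unions, and these are controlled by the ideals. Three facts make this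
  work.

  First, the least ideal belonging to the filter above \<open>\<alpha>\<close> and rejecting \<open>\<alpha> \<and> \<beta>\<close> is the principal
  ideal below \<open>\<alpha> \<rightarrow> \<beta>\<close>. This follows from \<open>Imp\<close>; moreover the pair is disjoint unless
  \<open>\<alpha> \<rightarrow> \<beta>\<close> is a theorem, because \<open>\<alpha> \<turnstile> \<alpha> \<rightarrow> \<beta>\<close> implies \<open>\<turnstile> \<alpha> \<rightarrow> \<beta>\<close> (\<open>canon_pair\<close>, \<open>F_imp_thm\<close>).
  Second, these principal worlds suffice to witness all failures, so forcing of \<open>\<alpha>\<^sup>O\<close> at a world is
  membership of \<open>\<alpha>\<close> in its filter (\<open>truth_lemma\<close>). Third, both Fischer Servi axioms reduce to a
  weak form of symmetry of \<open>S\<close> (\<open>ITB_sound\<close>): one may go back from \<open>y\<close> to \<open>x\<close> after enlarging \<open>x\<close>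
  in the intuitionistic order. In the canonical model one enlarges \<open>x\<close> by dropping from its ideal
  everything not forced into it by negation (\<open>canon_symmetric\<close>), and this is where
  \<open>\<alpha> \<turnstile> \<not>\<not>\<alpha>\<close> enters.
\<close>

section \<open>Derivations in intuitionistic KTB\<close>

lemma I_mp: "\<chi> \<turnstile>\<^sub>I\<^sub>T\<^sub>B \<phi> \<^bold>\<rightarrow>\<^sub>m \<psi> \<Longrightarrow> \<chi> \<turnstile>\<^sub>I\<^sub>T\<^sub>B \<phi> \<Longrightarrow> \<chi> \<turnstile>\<^sub>I\<^sub>T\<^sub>B \<psi>"
  by (meson I_andI I_impE I_refl I_trans)

lemma I_and_mono: "\<phi> \<turnstile>\<^sub>I\<^sub>T\<^sub>B \<phi>' \<Longrightarrow> \<psi> \<turnstile>\<^sub>I\<^sub>T\<^sub>B \<psi>' \<Longrightarrow> \<phi> \<^bold>\<and>\<^sub>m \<psi> \<turnstile>\<^sub>I\<^sub>T\<^sub>B \<phi>' \<^bold>\<and>\<^sub>m \<psi>'"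
  by (meson I_andI I_andE1 I_andE2 I_trans)

lemma I_imp_mono: "\<phi>' \<turnstile>\<^sub>I\<^sub>T\<^sub>B \<phi> \<Longrightarrow> \<psi> \<turnstile>\<^sub>I\<^sub>T\<^sub>B \<psi>' \<Longrightarrow> \<phi> \<^bold>\<rightarrow>\<^sub>m \<psi> \<turnstile>\<^sub>I\<^sub>T\<^sub>B \<phi>' \<^bold>\<rightarrow>\<^sub>m \<psi>'"
  by (meson I_impI I_mp I_andE1 I_andE2 I_trans)

lemma I_imp_weaken: "\<psi> \<turnstile>\<^sub>I\<^sub>T\<^sub>B \<phi> \<^bold>\<rightarrow>\<^sub>m \<psi>"
  by (rule I_impI[OF I_andE1])

lemma I_top: "\<phi> \<turnstile>\<^sub>I\<^sub>T\<^sub>B \<^bold>\<top>\<^sub>m"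
  by (rule I_impI[OF I_andE2])

lemma I_orE':
  assumes "\<phi> \<turnstile>\<^sub>I\<^sub>T\<^sub>B \<chi>" "\<psi> \<turnstile>\<^sub>I\<^sub>T\<^sub>B \<chi>"
  shows "\<phi> \<^bold>\<or>\<^sub>m \<psi> \<turnstile>\<^sub>I\<^sub>T\<^sub>B \<chi>"
proof -
  have "\<^bold>\<top>\<^sub>m \<^bold>\<and>\<^sub>m (\<phi> \<^bold>\<or>\<^sub>m \<psi>) \<turnstile>\<^sub>I\<^sub>T\<^sub>B \<chi>"
    by (rule I_orE) (use assms I_andE2 I_trans in blast)+
  then show ?thesis
    by (meson I_andI I_refl I_top I_trans)
qed

lemma I_box_dia_mono: "\<phi> \<turnstile>\<^sub>I\<^sub>T\<^sub>B \<psi> \<Longrightarrow> \<box> (\<diamond> \<phi>) \<turnstile>\<^sub>I\<^sub>T\<^sub>B \<box> (\<diamond> \<psi>)"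
  by (intro I_box_mono I_dia_mono)

lemma I_box_dia_box: "\<box> (\<diamond> (\<box> \<phi>)) \<turnstile>\<^sub>I\<^sub>T\<^sub>B \<box> \<phi>"
  by (rule I_box_mono[OF I_B_dia])

text \<open>
  The first Fischer Servi axiom, applied to the currying \<open>\<phi> \<turnstile> \<psi> \<rightarrow> \<bottom>\<close>, lets a necessary
  formula refute a possible one.
\<close>

lemma I_dia_box_bot:
  assumes "\<phi> \<^bold>\<and>\<^sub>m \<psi> \<turnstile>\<^sub>I\<^sub>T\<^sub>B \<^bold>\<bottom>\<^sub>m"
  shows "\<diamond> \<phi> \<^bold>\<and>\<^sub>m \<box> \<psi> \<turnstile>\<^sub>I\<^sub>T\<^sub>B \<^bold>\<bottom>\<^sub>m"
proof -
  have "\<diamond> \<phi> \<turnstile>\<^sub>I\<^sub>T\<^sub>B \<diamond> (\<psi> \<^bold>\<rightarrow>\<^sub>m \<^bold>\<bottom>\<^sub>m)"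
    by (rule I_dia_mono[OF I_impI[OF assms]])
  then have "\<diamond> \<phi> \<^bold>\<and>\<^sub>m \<box> \<psi> \<turnstile>\<^sub>I\<^sub>T\<^sub>B \<diamond> \<^bold>\<bottom>\<^sub>m"
    using I_dia_imp I_impE I_trans by blast
  then show ?thesis
    using I_dia_bot I_trans by blast
qed

section \<open>Soundness of the translation\<close>

text \<open>
  A formula beginning with \<open>\<box>\<close> is closed because \<open>\<diamond>\<box>\<phi> \<turnstile> \<phi>\<close>, and closed formulas are stable under
  conjunction by monotonicity; apart from \<open>\<bottom>\<close> and \<open>\<top>\<close> the translation produces nothing else.
\<close>

lemma box_dia_transO: "\<box> (\<diamond> (\<alpha>\<^sup>O)) \<turnstile>\<^sub>I\<^sub>T\<^sub>B \<alpha>\<^sup>O"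
proof (induction \<alpha>)
  case Bot
  then show ?case
    using I_T_box I_dia_bot I_trans by (simp, blast)
next
  case (And \<alpha> \<beta>)
  have "\<box> (\<diamond> ((\<alpha> \<^bold>\<and> \<beta>)\<^sup>O)) \<turnstile>\<^sub>I\<^sub>T\<^sub>B \<alpha>\<^sup>O" "\<box> (\<diamond> ((\<alpha> \<^bold>\<and> \<beta>)\<^sup>O)) \<turnstile>\<^sub>I\<^sub>T\<^sub>B \<beta>\<^sup>O"
    using And.IH by (simp_all, meson I_box_dia_mono I_andE1 I_andE2 I_trans)+
  then show ?case
    by (simp add: I_andI)
qed (simp_all add: I_top I_box_dia_box)

lemma transO_imp_mono:
  assumes "\<alpha>'\<^sup>O \<turnstile>\<^sub>I\<^sub>T\<^sub>B \<alpha>\<^sup>O" "\<alpha>\<^sup>O \<^bold>\<and>\<^sub>m \<beta>\<^sup>O \<turnstile>\<^sub>I\<^sub>T\<^sub>B \<alpha>'\<^sup>O \<^bold>\<and>\<^sub>m \<beta>'\<^sup>O"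
  shows "(\<alpha> \<^bold>\<rightarrow> \<beta>)\<^sup>O \<turnstile>\<^sub>I\<^sub>T\<^sub>B (\<alpha>' \<^bold>\<rightarrow> \<beta>')\<^sup>O"
  using assms by (simp add: I_box_mono I_imp_mono I_dia_mono)

lemma and_imp_transO: "(\<alpha> \<^bold>\<and> \<beta>)\<^sup>O \<turnstile>\<^sub>I\<^sub>T\<^sub>B (\<alpha> \<^bold>\<rightarrow> \<beta>)\<^sup>O"
  by (simp, rule I_trans[OF I_B_box I_box_mono[OF I_imp_weaken]])

lemma top_impE_transO: "(\<^bold>\<top> \<^bold>\<rightarrow> \<phi>)\<^sup>O \<turnstile>\<^sub>I\<^sub>T\<^sub>B \<phi>\<^sup>O"
proof -
  have "\<^bold>\<top>\<^sub>m \<^bold>\<rightarrow>\<^sub>m \<diamond> (\<^bold>\<top>\<^sub>m \<^bold>\<and>\<^sub>m \<phi>\<^sup>O) \<turnstile>\<^sub>I\<^sub>T\<^sub>B \<diamond> (\<phi>\<^sup>O)"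
    by (rule I_trans[OF I_mp[OF I_refl I_top] I_dia_mono[OF I_andE2]])
  then have "(\<^bold>\<top> \<^bold>\<rightarrow> \<phi>)\<^sup>O \<turnstile>\<^sub>I\<^sub>T\<^sub>B \<box> (\<diamond> (\<phi>\<^sup>O))"
    by (simp add: I_box_mono)
  then show ?thesis
    using box_dia_transO I_trans by blast
qed

lemma imp_Id_transO: "\<chi> \<turnstile>\<^sub>I\<^sub>T\<^sub>B (\<alpha> \<^bold>\<rightarrow> \<alpha>)\<^sup>O"
proof -
  have "\<^bold>\<top>\<^sub>m \<turnstile>\<^sub>I\<^sub>T\<^sub>B \<alpha>\<^sup>O \<^bold>\<rightarrow>\<^sub>m \<diamond> (\<alpha>\<^sup>O \<^bold>\<and>\<^sub>m \<alpha>\<^sup>O)"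
    by (meson I_impI I_andE2 I_andI I_T_dia I_trans)
  then show ?thesis
    by (simp, meson I_box_mono I_box_top I_top I_trans)
qed

text \<open>
  The consequent \<open>(\<alpha> \<rightarrow> \<beta>)\<^sup>O\<close> begins with \<open>\<box>\<close>, so its possibility already yields the implication
  under the \<open>\<box>\<close>; the side condition then restores the conjunct \<open>\<phi>\<close> that was lost in
  passing to another world.
\<close>

lemma Imp_transO:
  assumes "\<alpha>\<^sup>O \<^bold>\<and>\<^sub>m \<beta>\<^sup>O \<turnstile>\<^sub>I\<^sub>T\<^sub>B \<phi>\<^sup>O"
  shows "(\<phi> \<^bold>\<rightarrow> (\<alpha> \<^bold>\<rightarrow> \<beta>))\<^sup>O \<turnstile>\<^sub>I\<^sub>T\<^sub>B ((\<phi> \<^bold>\<and> \<alpha>) \<^bold>\<rightarrow> \<beta>)\<^sup>O"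
proof -
  let ?Y = "\<alpha>\<^sup>O \<^bold>\<rightarrow>\<^sub>m \<diamond> (\<alpha>\<^sup>O \<^bold>\<and>\<^sub>m \<beta>\<^sup>O)"
  let ?X = "\<phi>\<^sup>O \<^bold>\<rightarrow>\<^sub>m \<diamond> (\<phi>\<^sup>O \<^bold>\<and>\<^sub>m \<box> ?Y)"
  let ?H = "?X \<^bold>\<and>\<^sub>m (\<phi>\<^sup>O \<^bold>\<and>\<^sub>m \<alpha>\<^sup>O)"
  have "?H \<turnstile>\<^sub>I\<^sub>T\<^sub>B ?X" "?H \<turnstile>\<^sub>I\<^sub>T\<^sub>B \<phi>\<^sup>O" and \<alpha>: "?H \<turnstile>\<^sub>I\<^sub>T\<^sub>B \<alpha>\<^sup>O"
    by (meson I_andE1 I_andE2 I_trans)+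
  then have "?H \<turnstile>\<^sub>I\<^sub>T\<^sub>B \<diamond> (\<phi>\<^sup>O \<^bold>\<and>\<^sub>m \<box> ?Y)"
    by (meson I_mp)
  also have "\<diamond> (\<phi>\<^sup>O \<^bold>\<and>\<^sub>m \<box> ?Y) \<turnstile>\<^sub>I\<^sub>T\<^sub>B ?Y"
    by (rule I_trans[OF I_dia_mono[OF I_andE2] I_B_dia])
  finally (I_trans) have "?H \<turnstile>\<^sub>I\<^sub>T\<^sub>B \<diamond> (\<alpha>\<^sup>O \<^bold>\<and>\<^sub>m \<beta>\<^sup>O)"
    using \<alpha> I_mp by blast
  also have "\<diamond> (\<alpha>\<^sup>O \<^bold>\<and>\<^sub>m \<beta>\<^sup>O) \<turnstile>\<^sub>I\<^sub>T\<^sub>B \<diamond> ((\<phi>\<^sup>O \<^bold>\<and>\<^sub>m \<alpha>\<^sup>O) \<^bold>\<and>\<^sub>m \<beta>\<^sup>O)"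
    by (intro I_dia_mono I_andI assms I_andE1 I_andE2)
  finally (I_trans) show ?thesis
    by (simp add: I_box_mono I_impI)
qed

lemma Exp_transO: "\<alpha>\<^sup>O \<^bold>\<and>\<^sub>m (\<^bold>\<not> \<alpha>)\<^sup>O \<turnstile>\<^sub>I\<^sub>T\<^sub>B \<^bold>\<bottom>\<^sub>m"
proof -
  have "(\<^bold>\<not> \<alpha>)\<^sup>O \<turnstile>\<^sub>I\<^sub>T\<^sub>B \<alpha>\<^sup>O \<^bold>\<rightarrow>\<^sub>m \<^bold>\<bottom>\<^sub>m"
    by (simp, meson I_T_box I_imp_mono I_refl I_dia_mono I_andE2 I_dia_bot I_trans)
  then show ?thesis
    by (meson I_mp I_andE1 I_andE2 I_trans)
qed

lemma notnotI_transO: "\<alpha>\<^sup>O \<turnstile>\<^sub>I\<^sub>T\<^sub>B (\<^bold>\<not> (\<^bold>\<not> \<alpha>))\<^sup>O"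
proof -
  let ?N = "\<alpha>\<^sup>O \<^bold>\<rightarrow>\<^sub>m \<diamond> (\<alpha>\<^sup>O \<^bold>\<and>\<^sub>m \<^bold>\<bottom>\<^sub>m)"
  have "?N \<turnstile>\<^sub>I\<^sub>T\<^sub>B \<alpha>\<^sup>O \<^bold>\<rightarrow>\<^sub>m \<^bold>\<bottom>\<^sub>m"
    by (meson I_imp_mono I_refl I_dia_mono I_andE2 I_dia_bot I_trans)
  then have "\<alpha>\<^sup>O \<^bold>\<and>\<^sub>m ?N \<turnstile>\<^sub>I\<^sub>T\<^sub>B \<^bold>\<bottom>\<^sub>m"
    by (meson I_mp I_andE1 I_andE2 I_trans)
  then have "\<diamond> (\<alpha>\<^sup>O) \<^bold>\<and>\<^sub>m (\<^bold>\<not> \<alpha>)\<^sup>O \<turnstile>\<^sub>I\<^sub>T\<^sub>B \<^bold>\<bottom>\<^sub>m"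
    by (simp add: I_dia_box_bot)
  then have "\<diamond> (\<alpha>\<^sup>O) \<turnstile>\<^sub>I\<^sub>T\<^sub>B (\<^bold>\<not> \<alpha>)\<^sup>O \<^bold>\<rightarrow>\<^sub>m \<diamond> ((\<^bold>\<not> \<alpha>)\<^sup>O \<^bold>\<and>\<^sub>m \<^bold>\<bottom>\<^sub>m)"
    using I_botE I_impI I_trans by blast
  then have "\<box> (\<diamond> (\<alpha>\<^sup>O)) \<turnstile>\<^sub>I\<^sub>T\<^sub>B (\<^bold>\<not> (\<^bold>\<not> \<alpha>))\<^sup>O"
    by (simp add: I_box_mono)
  then show ?thesis
    using I_B_box I_trans by blast
qed

text \<open>
  Contexts in \<open>F\<close> may be infinite, so instead of a conjunction of the context the statement
  uses an arbitrary modal lower bound \<open>\<chi>\<close> of its translation.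
\<close>

lemma F_entails_transO:
  assumes "\<Gamma> \<turnstile>\<^sub>F \<phi>" "\<And>\<gamma>. \<gamma> \<in> \<Gamma> \<Longrightarrow> \<chi> \<turnstile>\<^sub>I\<^sub>T\<^sub>B \<gamma>\<^sup>O"
  shows "\<chi> \<turnstile>\<^sub>I\<^sub>T\<^sub>B \<phi>\<^sup>O"
  using assms
proof (induction arbitrary: \<chi> rule: F_entails.induct)
  case (F_Cut \<psi> \<Gamma> \<phi> \<Delta>)
  then show ?case by blast
next
  case (F_andI \<phi> \<psi>)
  then show ?case by (simp add: I_andI)
next
  case (F_andE1 \<phi> \<psi>)
  have "(\<phi> \<^bold>\<and> \<psi>)\<^sup>O \<turnstile>\<^sub>I\<^sub>T\<^sub>B \<phi>\<^sup>O" by (simp add: I_andE1)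
  with F_andE1 show ?case by (blast intro: I_trans)
next
  case (F_andE2 \<phi> \<psi>)
  have "(\<phi> \<^bold>\<and> \<psi>)\<^sup>O \<turnstile>\<^sub>I\<^sub>T\<^sub>B \<psi>\<^sup>O" by (simp add: I_andE2)
  with F_andE2 show ?case by (blast intro: I_trans)
next
  case (F_orI1 \<phi> \<psi>)
  have "\<phi>\<^sup>O \<turnstile>\<^sub>I\<^sub>T\<^sub>B (\<phi> \<^bold>\<or> \<psi>)\<^sup>O" by (simp, rule I_trans[OF I_orI1 I_B_box])
  with F_orI1 show ?case by (blast intro: I_trans)
next
  case (F_orI2 \<psi> \<phi>)
  have "\<psi>\<^sup>O \<turnstile>\<^sub>I\<^sub>T\<^sub>B (\<phi> \<^bold>\<or> \<psi>)\<^sup>O" by (simp, rule I_trans[OF I_orI2 I_B_box])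
  with F_orI2 show ?case by (blast intro: I_trans)
next
  case (F_orE \<phi> \<alpha> \<psi>)
  have "\<phi>\<^sup>O \<^bold>\<or>\<^sub>m \<psi>\<^sup>O \<turnstile>\<^sub>I\<^sub>T\<^sub>B \<alpha>\<^sup>O"
    using F_orE.IH I_refl by (intro I_orE') auto
  then have "(\<phi> \<^bold>\<or> \<psi>)\<^sup>O \<turnstile>\<^sub>I\<^sub>T\<^sub>B \<alpha>\<^sup>O"
    using I_trans[OF I_box_dia_mono box_dia_transO] by simp
  with F_orE.prems show ?case by (blast intro: I_trans)
next
  case (F_botE \<phi>)
  then show ?case using I_botE I_trans by fastforce
next
  case F_top
  then show ?case by (simp add: I_top)
next
  case (F_top_impE \<phi>)
  then show ?case by (blast intro: I_trans top_impE_transO)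
next
  case (F_Con \<alpha> \<beta> \<psi>)
  have "\<alpha>\<^sup>O \<^bold>\<and>\<^sub>m \<beta>\<^sup>O \<turnstile>\<^sub>I\<^sub>T\<^sub>B \<psi>\<^sup>O"
    using F_Con.IH[of "\<alpha>\<^sup>O \<^bold>\<and>\<^sub>m \<beta>\<^sup>O"] by (simp add: I_refl)
  then have "(\<alpha> \<^bold>\<rightarrow> \<beta>)\<^sup>O \<turnstile>\<^sub>I\<^sub>T\<^sub>B (\<alpha> \<^bold>\<rightarrow> \<psi>)\<^sup>O"
    by (intro transO_imp_mono I_refl I_andI I_andE1)
  with F_Con.prems show ?case by (blast intro: I_trans)
next
  case (F_and_imp \<alpha> \<beta>)
  then show ?case by (blast intro: I_trans and_imp_transO)
next
  case (F_Imp \<alpha> \<beta> \<phi>)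
  have "\<alpha>\<^sup>O \<^bold>\<and>\<^sub>m \<beta>\<^sup>O \<turnstile>\<^sub>I\<^sub>T\<^sub>B \<phi>\<^sup>O"
    using F_Imp.IH[of "\<alpha>\<^sup>O \<^bold>\<and>\<^sub>m \<beta>\<^sup>O"] by (simp add: I_refl)
  with F_Imp.prems show ?case by (blast intro: I_trans Imp_transO)
next
  case (F_Rep1 \<alpha> \<alpha>' \<beta>)
  have "(\<alpha> \<^bold>\<rightarrow> \<beta>)\<^sup>O \<turnstile>\<^sub>I\<^sub>T\<^sub>B (\<alpha>' \<^bold>\<rightarrow> \<beta>)\<^sup>O"
    using F_Rep1.IH I_refl by (intro transO_imp_mono I_and_mono) auto
  with F_Rep1.prems show ?case by (blast intro: I_trans)
next
  case (F_Rep2 \<alpha> \<alpha>' \<beta>)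
  have "(\<alpha>' \<^bold>\<rightarrow> \<beta>)\<^sup>O \<turnstile>\<^sub>I\<^sub>T\<^sub>B (\<alpha> \<^bold>\<rightarrow> \<beta>)\<^sup>O"
    using F_Rep2.IH I_refl by (intro transO_imp_mono I_and_mono) auto
  with F_Rep2.prems show ?case by (blast intro: I_trans)
next
  case (F_Exp \<alpha>)
  then have "\<chi> \<turnstile>\<^sub>I\<^sub>T\<^sub>B \<alpha>\<^sup>O \<^bold>\<and>\<^sub>m (\<^bold>\<not> \<alpha>)\<^sup>O" by (blast intro: I_andI)
  then show ?case using Exp_transO I_trans by fastforce
next
  case (F_notnotI \<alpha>)
  then show ?case by (blast intro: I_trans notnotI_transO)
qed (use imp_Id_transO in auto)

section \<open>Relational models of intuitionistic KTB\<close>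

text \<open>
  Both modalities use the same relation, \<open>\<box>\<close> forward and \<open>\<diamond>\<close> backward, as the adjunction expressed
  by the \<open>B\<close> axioms dictates. Since \<open>S\<close> absorbs the order on both sides, the modal clauses
  need no quantification over the order. Symmetry holds only up to enlarging the starting world.
\<close>

locale itb_model =
  fixes W :: "'w set"
    and le :: "'w \<Rightarrow> 'w \<Rightarrow> bool" (infix "\<preceq>" 50)
    and S :: "'w \<Rightarrow> 'w \<Rightarrow> bool" (infix "\<leadsto>" 50)
    and V :: "'p \<Rightarrow> 'w set"
  assumes le_refl: "x \<preceq> x"
    and le_trans: "x \<preceq> y \<Longrightarrow> y \<preceq> z \<Longrightarrow> x \<preceq> z"
    and S_refl: "x \<in> W \<Longrightarrow> x \<leadsto> x"
    and le_S: "x \<preceq> y \<Longrightarrow> y \<leadsto> z \<Longrightarrow> x \<leadsto> z"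
    and S_le: "x \<leadsto> y \<Longrightarrow> y \<preceq> z \<Longrightarrow> x \<leadsto> z"
    and S_symmetric: "x \<in> W \<Longrightarrow> y \<in> W \<Longrightarrow> x \<leadsto> y \<Longrightarrow> \<exists>x'\<in>W. x \<preceq> x' \<and> y \<leadsto> x' \<and> x' \<leadsto> y"
    and V_mono: "x \<preceq> y \<Longrightarrow> x \<in> V p \<Longrightarrow> y \<in> V p"
begin

primrec forces :: "'w \<Rightarrow> 'p mform \<Rightarrow> bool" (infix "\<tturnstile>" 50) where
  "w \<tturnstile> MVar p \<longleftrightarrow> w \<in> V p"
| "w \<tturnstile> \<^bold>\<bottom>\<^sub>m \<longleftrightarrow> False"
| "w \<tturnstile> \<phi> \<^bold>\<and>\<^sub>m \<psi> \<longleftrightarrow> w \<tturnstile> \<phi> \<and> w \<tturnstile> \<psi>"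
| "w \<tturnstile> \<phi> \<^bold>\<or>\<^sub>m \<psi> \<longleftrightarrow> w \<tturnstile> \<phi> \<or> w \<tturnstile> \<psi>"
| "w \<tturnstile> \<phi> \<^bold>\<rightarrow>\<^sub>m \<psi> \<longleftrightarrow> (\<forall>v\<in>W. w \<preceq> v \<longrightarrow> v \<tturnstile> \<phi> \<longrightarrow> v \<tturnstile> \<psi>)"
| "w \<tturnstile> \<box> \<phi> \<longleftrightarrow> (\<forall>v\<in>W. w \<leadsto> v \<longrightarrow> v \<tturnstile> \<phi>)"
| "w \<tturnstile> \<diamond> \<phi> \<longleftrightarrow> (\<exists>v\<in>W. v \<leadsto> w \<and> v \<tturnstile> \<phi>)"

lemma forces_mono: "w \<preceq> v \<Longrightarrow> w \<tturnstile> \<phi> \<Longrightarrow> v \<tturnstile> \<phi>"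
proof (induction \<phi> arbitrary: w v)
  case (MVar p)
  then show ?case using V_mono by simp
next
  case (MImp \<phi> \<psi>)
  then show ?case using le_trans by auto
next
  case (Box \<phi>)
  then show ?case using le_S by auto
next
  case (Dia \<phi>)
  then show ?case using S_le by fastforce
qed auto

lemma ITB_sound: "\<phi> \<turnstile>\<^sub>I\<^sub>T\<^sub>B \<psi> \<Longrightarrow> w \<in> W \<Longrightarrow> w \<tturnstile> \<phi> \<Longrightarrow> w \<tturnstile> \<psi>"
proof (induction arbitrary: w rule: ITB_entails.induct)
  case (I_impI \<phi> \<psi> \<chi>)
  then show ?case using forces_mono by auto
next
  case (I_impE \<phi> \<psi> \<chi>)
  then show ?case using le_refl by auto
next
  case (I_dia_imp \<phi> \<psi>)
  have "v \<tturnstile> \<diamond> \<psi>" if v: "v \<in> W" "w \<preceq> v" "v \<tturnstile> \<box> \<phi>" for v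
  proof -
    obtain u where u: "u \<in> W" "u \<leadsto> w" "u \<tturnstile> \<phi> \<^bold>\<rightarrow>\<^sub>m \<psi>"
      using I_dia_imp by auto
    then have "u \<leadsto> v" using v S_le by blast
    \<comment> \<open>The enlarged \<open>u'\<close> is seen from \<open>v\<close>, hence forces \<open>\<phi>\<close>, and it sees \<open>v\<close>, hence
      witnesses \<open>\<diamond>\<psi>\<close> there.\<close>
    then obtain u' where "u' \<in> W" "u \<preceq> u'" "v \<leadsto> u'" "u' \<leadsto> v"
      using S_symmetric u v by blast
    with u v show ?thesis by auto
  qed
  then show ?case by simp
next
  case (I_imp_box \<phi> \<psi>)
  have "v \<tturnstile> \<psi>" if v: "u \<in> W" "w \<leadsto> u" "v \<in> W" "u \<preceq> v" "v \<tturnstile> \<phi>" for u v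
  proof -
    have "w \<leadsto> v" using v S_le by blast
    then obtain w' where "w' \<in> W" "w \<preceq> w'" "v \<leadsto> w'" "w' \<leadsto> v"
      using S_symmetric I_imp_box v by blast
    with I_imp_box v show ?thesis by auto
  qed
  then show ?case by simp
next
  case (I_T_box \<phi>)
  then show ?case using S_refl by auto
next
  case (I_T_dia \<phi>)
  then show ?case using S_refl by auto
qed auto

end

section \<open>Derivations in the system F\<close>

lemma F_refl: "{\<alpha>} \<turnstile>\<^sub>F \<alpha>"
  using F_A[of \<alpha> "{}"] by simp

lemma F_trans: "{\<alpha>} \<turnstile>\<^sub>F \<beta> \<Longrightarrow> {\<beta>} \<turnstile>\<^sub>F \<gamma> \<Longrightarrow> {\<alpha>} \<turnstile>\<^sub>F \<gamma>"
  using F_Cut[of \<beta> "{}" \<gamma> "{\<alpha>}"] by simp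

lemma F_weaken: "{} \<turnstile>\<^sub>F \<beta> \<Longrightarrow> {\<alpha>} \<turnstile>\<^sub>F \<beta>"
  using F_Cut[OF F_A, of "{}" \<beta> "{\<alpha>}"] by simp

lemma F_thm: "{} \<turnstile>\<^sub>F \<alpha> \<Longrightarrow> {\<alpha>} \<turnstile>\<^sub>F \<beta> \<Longrightarrow> {} \<turnstile>\<^sub>F \<beta>"
  using F_Cut[of \<alpha> "{}" \<beta> "{}"] by simp

lemma F_cut_pair:
  assumes "{\<alpha>} \<turnstile>\<^sub>F \<beta>" "{\<alpha>} \<turnstile>\<^sub>F \<gamma>" "{\<beta>, \<gamma>} \<turnstile>\<^sub>F \<delta>"
  shows "{\<alpha>} \<turnstile>\<^sub>F \<delta>"
proof -
  have "insert \<gamma> {\<alpha>} \<turnstile>\<^sub>F \<delta>"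
    using F_Cut[of \<beta> "{\<gamma>}" \<delta> "{\<alpha>}"] assms(1,3) by (simp add: insert_commute)
  then show ?thesis
    using F_Cut[of \<gamma> "{\<alpha>}" \<delta> "{\<alpha>}"] assms(2) by simp
qed

lemma F_and_intro: "{\<alpha>} \<turnstile>\<^sub>F \<beta> \<Longrightarrow> {\<alpha>} \<turnstile>\<^sub>F \<gamma> \<Longrightarrow> {\<alpha>} \<turnstile>\<^sub>F \<beta> \<^bold>\<and> \<gamma>"
  using F_cut_pair F_andI by blast

text \<open>
  Consequents may be weakened after adding the antecedent to them, so
  \<open>\<gamma> \<and> \<delta> \<turnstile> \<alpha> \<rightarrow> \<beta>\<close> gives a nested implication, which \<open>Imp\<close> flattens. It is in this form that \<open>Imp\<close>
  describes the ideals of the canonical model.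
\<close>

lemma F_imp_least:
  assumes "{\<alpha>} \<turnstile>\<^sub>F \<gamma>" "{\<gamma> \<^bold>\<and> \<delta>} \<turnstile>\<^sub>F \<alpha> \<^bold>\<rightarrow> \<beta>"
  shows "{\<gamma> \<^bold>\<rightarrow> \<delta>} \<turnstile>\<^sub>F \<alpha> \<^bold>\<rightarrow> \<beta>"
proof -
  have "{\<gamma> \<^bold>\<rightarrow> \<delta>} \<turnstile>\<^sub>F \<gamma> \<^bold>\<rightarrow> (\<alpha> \<^bold>\<rightarrow> \<beta>)"
    by (rule F_Con[OF assms(2)])
  moreover have "{\<gamma> \<^bold>\<rightarrow> (\<alpha> \<^bold>\<rightarrow> \<beta>)} \<turnstile>\<^sub>F (\<gamma> \<^bold>\<and> \<alpha>) \<^bold>\<rightarrow> \<beta>"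
    by (rule F_Imp[OF F_trans[OF F_andE1 assms(1)]])
  moreover have "{(\<gamma> \<^bold>\<and> \<alpha>) \<^bold>\<rightarrow> \<beta>} \<turnstile>\<^sub>F \<alpha> \<^bold>\<rightarrow> \<beta>"
    by (rule F_Rep1[OF F_andE2 F_and_intro[OF assms(1) F_refl]])
  ultimately show ?thesis
    using F_trans by blast
qed

lemma F_neg_antimono: "{\<alpha>} \<turnstile>\<^sub>F \<gamma> \<Longrightarrow> {\<^bold>\<not> \<gamma>} \<turnstile>\<^sub>F \<^bold>\<not> \<alpha>"
  by (rule F_imp_least) (auto intro: F_trans[OF F_andE2 F_botE])

text \<open>The theorem \<open>\<alpha> \<rightarrow> \<alpha>\<close> lies below \<open>\<alpha> \<rightarrow> \<beta>\<close> by the preceding comparison.\<close>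

lemma F_imp_thm: "{\<alpha>} \<turnstile>\<^sub>F \<alpha> \<^bold>\<rightarrow> \<beta> \<Longrightarrow> {} \<turnstile>\<^sub>F \<alpha> \<^bold>\<rightarrow> \<beta>"
  by (rule F_thm[OF F_imp_Id F_imp_least[OF F_refl F_trans[OF F_andE1]]])

lemma F_neg_inconsistent: "{\<alpha>} \<turnstile>\<^sub>F \<^bold>\<not> \<alpha> \<Longrightarrow> {\<alpha>} \<turnstile>\<^sub>F \<^bold>\<bottom>"
  using F_cut_pair F_refl F_Exp by blast

section \<open>The canonical model\<close>

definition F_filter :: "'p form set \<Rightarrow> bool" where
  "F_filter T \<longleftrightarrow> \<^bold>\<top> \<in> T \<and> (\<forall>\<alpha>\<in>T. \<forall>\<beta>. {\<alpha>} \<turnstile>\<^sub>F \<beta> \<longrightarrow> \<beta> \<in> T) \<and> (\<forall>\<alpha>\<in>T. \<forall>\<beta>\<in>T. \<alpha> \<^bold>\<and> \<beta> \<in> T)"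

definition F_ideal :: "'p form set \<Rightarrow> bool" where
  "F_ideal R \<longleftrightarrow> \<^bold>\<bottom> \<in> R \<and> (\<forall>\<beta>\<in>R. \<forall>\<alpha>. {\<alpha>} \<turnstile>\<^sub>F \<beta> \<longrightarrow> \<alpha> \<in> R) \<and> (\<forall>\<alpha>\<in>R. \<forall>\<beta>\<in>R. \<alpha> \<^bold>\<or> \<beta> \<in> R)"

text \<open>
  A world pairs its accepted with its rejected formulas. The last clause makes an
  accepted \<open>\<alpha> \<rightarrow> \<beta>\<close> usable at the worlds seen: if such a world accepts \<open>\<alpha>\<close>, it cannot
  reject \<open>\<alpha> \<and> \<beta>\<close>, since it would then reject \<open>\<alpha> \<rightarrow> \<beta>\<close>.
\<close>

definition canon :: "('p form set \<times> 'p form set) set" where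
  "canon = {(T, R). F_filter T \<and> F_ideal R \<and> T \<inter> R = {} \<and>
     (\<forall>\<alpha> \<beta>. \<alpha> \<in> T \<longrightarrow> \<alpha> \<^bold>\<and> \<beta> \<in> R \<longrightarrow> \<alpha> \<^bold>\<rightarrow> \<beta> \<in> R)}"

definition canon_le :: "'p form set \<times> 'p form set \<Rightarrow> 'p form set \<times> 'p form set \<Rightarrow> bool" where
  "canon_le x y \<longleftrightarrow> fst x \<subseteq> fst y \<and> snd y \<subseteq> snd x"

definition canon_S :: "'p form set \<times> 'p form set \<Rightarrow> 'p form set \<times> 'p form set \<Rightarrow> bool" where
  "canon_S x y \<longleftrightarrow> fst x \<inter> snd y = {}"

lemma canon_up: "x \<in> canon \<Longrightarrow> \<alpha> \<in> fst x \<Longrightarrow> {\<alpha>} \<turnstile>\<^sub>F \<beta> \<Longrightarrow> \<beta> \<in> fst x"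
  by (auto simp: canon_def F_filter_def)

lemma canon_down: "x \<in> canon \<Longrightarrow> \<beta> \<in> snd x \<Longrightarrow> {\<alpha>} \<turnstile>\<^sub>F \<beta> \<Longrightarrow> \<alpha> \<in> snd x"
  by (auto simp: canon_def F_ideal_def)

lemma canon_top: "x \<in> canon \<Longrightarrow> \<^bold>\<top> \<in> fst x"
  by (auto simp: canon_def F_filter_def)

lemma canon_bot: "x \<in> canon \<Longrightarrow> \<^bold>\<bottom> \<in> snd x"
  by (auto simp: canon_def F_ideal_def)

lemma canon_bot_notin: "x \<in> canon \<Longrightarrow> \<^bold>\<bottom> \<notin> fst x"
  by (auto simp: canon_def F_ideal_def)

lemma canon_and_closed: "x \<in> canon \<Longrightarrow> \<alpha> \<in> fst x \<Longrightarrow> \<beta> \<in> fst x \<Longrightarrow> \<alpha> \<^bold>\<and> \<beta> \<in> fst x"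
  by (auto simp: canon_def F_filter_def)

lemma canon_or_closed: "x \<in> canon \<Longrightarrow> \<alpha> \<in> snd x \<Longrightarrow> \<beta> \<in> snd x \<Longrightarrow> \<alpha> \<^bold>\<or> \<beta> \<in> snd x"
  by (auto simp: canon_def F_ideal_def)

lemma canon_and: "x \<in> canon \<Longrightarrow> \<alpha> \<^bold>\<and> \<beta> \<in> fst x \<longleftrightarrow> \<alpha> \<in> fst x \<and> \<beta> \<in> fst x"
  using canon_up F_andE1 F_andE2 canon_and_closed by blast

lemma canon_or: "x \<in> canon \<Longrightarrow> \<alpha> \<^bold>\<or> \<beta> \<in> snd x \<longleftrightarrow> \<alpha> \<in> snd x \<and> \<beta> \<in> snd x"
  using canon_down F_orI1 F_orI2 canon_or_closed by blast

lemma canon_imp: "x \<in> canon \<Longrightarrow> \<alpha> \<in> fst x \<Longrightarrow> \<alpha> \<^bold>\<and> \<beta> \<in> snd x \<Longrightarrow> \<alpha> \<^bold>\<rightarrow> \<beta> \<in> snd x"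
  by (auto simp: canon_def)

text \<open>
  The principal pair of \<open>\<alpha>\<close> and \<open>\<alpha> \<rightarrow> \<beta>\<close> satisfies the last clause for worlds by \<open>F_imp_least\<close>. Its two
  components can only meet if \<open>\<alpha> \<turnstile> \<alpha> \<rightarrow> \<beta>\<close>.
\<close>

lemma canon_pair:
  assumes "\<not> {} \<turnstile>\<^sub>F \<alpha> \<^bold>\<rightarrow> \<beta>"
  shows "({\<gamma>. {\<alpha>} \<turnstile>\<^sub>F \<gamma>}, {\<gamma>. {\<gamma>} \<turnstile>\<^sub>F \<alpha> \<^bold>\<rightarrow> \<beta>}) \<in> canon"
proof -
  have "\<not> {\<alpha>} \<turnstile>\<^sub>F \<alpha> \<^bold>\<rightarrow> \<beta>"
    using assms F_imp_thm by blast
  then show ?thesis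
    by (auto simp: canon_def F_filter_def F_ideal_def
        intro: F_trans F_and_intro F_orE F_botE F_weaken F_top F_imp_least)
qed

text \<open>
  The ideal below \<open>\<not>\<alpha>\<close> serves, because \<open>\<alpha> \<turnstile> \<not>\<alpha>\<close> would make \<open>\<alpha>\<close> inconsistent.
\<close>

lemma canon_consistent:
  assumes "\<not> {\<alpha>} \<turnstile>\<^sub>F \<^bold>\<bottom>"
  shows "\<exists>x\<in>canon. fst x = {\<gamma>. {\<alpha>} \<turnstile>\<^sub>F \<gamma>}"
proof -
  have "\<not> {} \<turnstile>\<^sub>F \<^bold>\<not> \<alpha>"
    using assms F_neg_inconsistent F_weaken by blast
  from canon_pair[OF this] show ?thesis
    by force
qed

lemma canon_accept_iff:
  assumes "y \<in> canon"
  shows "(\<exists>z\<in>canon. canon_S z y \<and> \<alpha> \<in> fst z) \<longleftrightarrow> \<alpha> \<notin> snd y"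
proof
  assume "\<alpha> \<notin> snd y"
  then have "\<not> {\<alpha>} \<turnstile>\<^sub>F \<^bold>\<bottom>"
    using assms canon_bot canon_down by blast
  then obtain z where z: "z \<in> canon" "fst z = {\<gamma>. {\<alpha>} \<turnstile>\<^sub>F \<gamma>}"
    using canon_consistent by blast
  moreover have "canon_S z y"
    unfolding canon_S_def z(2) using \<open>\<alpha> \<notin> snd y\<close> canon_down[OF assms] by blast
  ultimately show "\<exists>z\<in>canon. canon_S z y \<and> \<alpha> \<in> fst z"
    using F_refl by blast
qed (auto simp: canon_S_def)

lemma canon_imp_iff:
  assumes "x \<in> canon"
  shows "(\<forall>y\<in>canon. canon_S x y \<longrightarrow> \<alpha> \<in> fst y \<longrightarrow> \<alpha> \<^bold>\<and> \<beta> \<notin> snd y) \<longleftrightarrow> \<alpha> \<^bold>\<rightarrow> \<beta> \<in> fst x"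
proof
  assume *: "\<forall>y\<in>canon. canon_S x y \<longrightarrow> \<alpha> \<in> fst y \<longrightarrow> \<alpha> \<^bold>\<and> \<beta> \<notin> snd y"
  show "\<alpha> \<^bold>\<rightarrow> \<beta> \<in> fst x"
  proof (rule ccontr)
    assume notin: "\<alpha> \<^bold>\<rightarrow> \<beta> \<notin> fst x"
    let ?y = "({\<gamma>. {\<alpha>} \<turnstile>\<^sub>F \<gamma>}, {\<gamma>. {\<gamma>} \<turnstile>\<^sub>F \<alpha> \<^bold>\<rightarrow> \<beta>})"
    have "\<not> {} \<turnstile>\<^sub>F \<alpha> \<^bold>\<rightarrow> \<beta>"
      using notin assms canon_top canon_up F_weaken by blast
    then have "?y \<in> canon"
      by (rule canon_pair)
    moreover have "canon_S x ?y"
      unfolding canon_S_def snd_conv using notin canon_up[OF assms] by blast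
    ultimately show False
      using * F_refl F_and_imp by fastforce
  qed
next
  assume "\<alpha> \<^bold>\<rightarrow> \<beta> \<in> fst x"
  then show "\<forall>y\<in>canon. canon_S x y \<longrightarrow> \<alpha> \<in> fst y \<longrightarrow> \<alpha> \<^bold>\<and> \<beta> \<notin> snd y"
    unfolding canon_S_def using canon_imp by blast
qed

text \<open>
  This is the previous equivalence for \<open>\<top> \<rightarrow> \<alpha>\<close>, which is interderivable with \<open>\<alpha>\<close>. Together
  with \<open>canon_accept_iff\<close> it says that the set of worlds accepting \<open>\<alpha>\<close> is closed under \<open>\<box>\<diamond>\<close>.
\<close>

lemma canon_closed_iff:
  assumes "x \<in> canon"
  shows "(\<forall>y\<in>canon. canon_S x y \<longrightarrow> \<alpha> \<notin> snd y) \<longleftrightarrow> \<alpha> \<in> fst x"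
proof
  assume *: "\<forall>y\<in>canon. canon_S x y \<longrightarrow> \<alpha> \<notin> snd y"
  have "{\<alpha>} \<turnstile>\<^sub>F \<^bold>\<top> \<^bold>\<and> \<alpha>"
    by (intro F_and_intro F_weaken F_top F_refl)
  then have "\<forall>y\<in>canon. canon_S x y \<longrightarrow> \<^bold>\<top> \<in> fst y \<longrightarrow> \<^bold>\<top> \<^bold>\<and> \<alpha> \<notin> snd y"
    using * canon_down by blast
  then have "\<^bold>\<top> \<^bold>\<rightarrow> \<alpha> \<in> fst x"
    using canon_imp_iff[OF assms] by blast
  then show "\<alpha> \<in> fst x"
    using assms canon_up F_top_impE by blast
qed (auto simp: canon_S_def)

text \<open>
  The ideal of \<open>x\<close> is shrunk to the least one that its filter permits, the formulas below negations
  of accepted ones. A world \<open>y\<close> accepting such a \<open>\<not>\<alpha>\<close> would reject \<open>\<not>\<not>\<alpha>\<close> and hence \<open>\<alpha>\<close>, so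
  \<open>x\<close> would not see it.
\<close>

lemma canon_symmetric:
  assumes x: "x \<in> canon" and y: "y \<in> canon" and S: "canon_S x y"
  shows "\<exists>x'\<in>canon. canon_le x x' \<and> canon_S y x' \<and> canon_S x' y"
proof -
  let ?R = "{\<gamma>. \<exists>\<alpha>\<in>fst x. {\<gamma>} \<turnstile>\<^sub>F \<^bold>\<not> \<alpha>}"
  let ?x' = "(fst x, ?R)"
  have neg_rejected: "\<^bold>\<not> \<alpha> \<in> snd z" if "z \<in> canon" "\<alpha> \<in> fst z" for z \<alpha>
    using canon_imp[OF that] canon_down[OF \<open>z \<in> canon\<close> canon_bot F_andE2] that by blast
  have sub: "?R \<subseteq> snd x"
    using neg_rejected canon_down x by blast
  have "F_ideal ?R"
  proof -
    have "\<gamma> \<^bold>\<or> \<delta> \<in> ?R" if R: "\<gamma> \<in> ?R" "\<delta> \<in> ?R" for \<gamma> \<delta>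
    proof -
      obtain \<alpha> \<beta> where *: "\<alpha> \<in> fst x" "{\<gamma>} \<turnstile>\<^sub>F \<^bold>\<not> \<alpha>" "\<beta> \<in> fst x" "{\<delta>} \<turnstile>\<^sub>F \<^bold>\<not> \<beta>"
        using R by blast
      have "{\<gamma>} \<turnstile>\<^sub>F \<^bold>\<not> (\<alpha> \<^bold>\<and> \<beta>)" "{\<delta>} \<turnstile>\<^sub>F \<^bold>\<not> (\<alpha> \<^bold>\<and> \<beta>)"
        using * F_trans F_neg_antimono F_andE1 F_andE2 by blast+
      then show ?thesis
        using * x canon_and F_orE by blast
    qed
    then show ?thesis
      using canon_top[OF x] by (auto simp: F_ideal_def intro: F_botE F_trans)
  qed
  moreover have "\<alpha> \<^bold>\<rightarrow> \<beta> \<in> ?R" if \<alpha>: "\<alpha> \<in> fst x" and R: "\<alpha> \<^bold>\<and> \<beta> \<in> ?R" for \<alpha> \<beta>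
  proof -
    obtain \<gamma> where "\<gamma> \<in> fst x" "{\<alpha> \<^bold>\<and> \<beta>} \<turnstile>\<^sub>F \<^bold>\<not> \<gamma>"
      using R by blast
    \<comment> \<open>\<open>F_imp_least\<close> needs an antecedent that entails \<open>\<alpha>\<close>, so \<open>\<gamma>\<close> is strengthened by \<open>\<alpha>\<close>.\<close>
    then have "{\<alpha> \<^bold>\<rightarrow> \<beta>} \<turnstile>\<^sub>F \<^bold>\<not> (\<alpha> \<^bold>\<and> \<gamma>)"
      by (meson F_imp_least F_trans F_neg_antimono F_andE1 F_andE2)
    then show ?thesis
      using canon_and[OF x] \<alpha> \<open>\<gamma> \<in> fst x\<close> by blast
  qed
  ultimately have "?x' \<in> canon"
    using x sub unfolding canon_def by fastforce
  moreover have "canon_le x ?x'"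
    using sub by (simp add: canon_le_def)
  moreover have "canon_S ?x' y"
    using S by (simp add: canon_S_def)
  moreover have "canon_S y ?x'"
  proof -
    have False if "\<alpha> \<in> fst x" "{\<gamma>} \<turnstile>\<^sub>F \<^bold>\<not> \<alpha>" "\<gamma> \<in> fst y" for \<alpha> \<gamma>
    proof -
      have "\<^bold>\<not> (\<^bold>\<not> \<alpha>) \<in> snd y"
        using neg_rejected canon_up that y by blast
      then have "\<alpha> \<in> snd y"
        using canon_down[OF y] F_notnotI by blast
      then show False
        using S that by (auto simp: canon_S_def)
    qed
    then show ?thesis
      by (auto simp: canon_S_def)
  qed
  ultimately show ?thesis
    by blast
qed

interpretation canon: itb_model canon canon_le canon_S "\<lambda>p. {x. Var p \<in> fst x}"
proof
  show "canon_S x x" if "x \<in> canon" for x :: "'a form set \<times> 'a form set"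
    using that by (auto simp: canon_def canon_S_def)
  show "\<exists>x'\<in>canon. canon_le x x' \<and> canon_S y x' \<and> canon_S x' y"
    if "x \<in> canon" "y \<in> canon" "canon_S x y" for x y :: "'a form set \<times> 'a form set"
    using canon_symmetric that .
qed (auto simp: canon_le_def canon_S_def)

text \<open>
  Since worlds accept exactly what no visible world rejects, and a formula fails to be rejected
  exactly when it is possible, each modal clause turns into a condition on ideals. For disjunction
  this reduces to the ideal property, so no prime filters are needed.
\<close>

lemma truth_lemma: "x \<in> canon \<Longrightarrow> canon.forces x (\<alpha>\<^sup>O) \<longleftrightarrow> \<alpha> \<in> fst x"
proof (induction \<alpha> arbitrary: x)
  case (Var p)
  then show ?case
    by (simp add: canon_accept_iff canon_closed_iff)
next
  case Bot
  then show ?case by (simp add: canon_bot_notin)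
next
  case Top
  then show ?case by (simp add: canon_top)
next
  case (And \<alpha> \<beta>)
  then show ?case by (simp add: canon_and)
next
  case (Or \<alpha> \<beta>)
  have "canon.forces y (\<diamond> (\<alpha>\<^sup>O \<^bold>\<or>\<^sub>m \<beta>\<^sup>O)) \<longleftrightarrow> \<alpha> \<^bold>\<or> \<beta> \<notin> snd y" if "y \<in> canon" for y
    using that canon_accept_iff[OF that, of \<alpha>] canon_accept_iff[OF that, of \<beta>]
    by (auto simp: Or.IH canon_or)
  with Or.prems show ?case
    by (simp add: canon_closed_iff)
next
  case (Imp \<alpha> \<beta>)
  have dia: "canon.forces y (\<diamond> (\<alpha>\<^sup>O \<^bold>\<and>\<^sub>m \<beta>\<^sup>O)) \<longleftrightarrow> \<alpha> \<^bold>\<and> \<beta> \<notin> snd y" if "y \<in> canon" for y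
    using canon_accept_iff[OF that, of "\<alpha> \<^bold>\<and> \<beta>"] by (auto simp: Imp.IH canon_and)
  have "canon.forces x ((\<alpha> \<^bold>\<rightarrow> \<beta>)\<^sup>O) \<longleftrightarrow>
      (\<forall>y\<in>canon. canon_S x y \<longrightarrow> canon.forces y (\<alpha>\<^sup>O) \<longrightarrow> canon.forces y (\<diamond> (\<alpha>\<^sup>O \<^bold>\<and>\<^sub>m \<beta>\<^sup>O)))"
    \<comment> \<open>The order step inside the implication is absorbed by the preceding \<open>S\<close> step.\<close>
    unfolding transO.simps canon.forces.simps(5,6)
    using canon.S_le canon.le_refl by blast
  with Imp.prems show ?case
    using dia canon_imp_iff[OF Imp.prems, of \<alpha> \<beta>] Imp.IH(1) by blast
qed

section \<open>Full and faithful embedding\<close>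

theorem theorem9p14:
  fixes \<phi> \<psi> :: "'p :: countable form"
  shows "{\<phi>} \<turnstile>\<^sub>F \<psi> \<longleftrightarrow> \<phi>\<^sup>O \<turnstile>\<^sub>I\<^sub>T\<^sub>B \<psi>\<^sup>O"
proof
  assume "{\<phi>} \<turnstile>\<^sub>F \<psi>"
  then show "\<phi>\<^sup>O \<turnstile>\<^sub>I\<^sub>T\<^sub>B \<psi>\<^sup>O"
    using F_entails_transO I_refl by blast
next
  assume *: "\<phi>\<^sup>O \<turnstile>\<^sub>I\<^sub>T\<^sub>B \<psi>\<^sup>O"
  show "{\<phi>} \<turnstile>\<^sub>F \<psi>"
  proof (cases "{\<phi>} \<turnstile>\<^sub>F \<^bold>\<bottom>")
    case True
    then show ?thesis using F_trans F_botE by blast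
  next
    case False
    then obtain x where x: "x \<in> canon" "fst x = {\<gamma>. {\<phi>} \<turnstile>\<^sub>F \<gamma>}"
      using canon_consistent by blast
    then have "canon.forces x (\<phi>\<^sup>O)"
      using truth_lemma F_refl by blast
    then have "canon.forces x (\<psi>\<^sup>O)"
      using canon.ITB_sound * x by blast
    then show ?thesis
      using truth_lemma x by blast
  qed
qed

end
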